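(* Let $D=\{1,\dots,d\}$, let $X=(X_1,\dots,X_d)$ be a random vector in $\mathbb{R}^d$ and let $F:\mathbb{R}^d\to\mathbb{R}$ be measurable with $\mathbb{E}[F(X)^2]<\infty$. Let $m^{(\mathrm{sens})}$ be the Möbius transform of the global sensitivity game $\nu^{(\mathrm{sens})}(S):=\mathbb{V}[F^{(c)}_S(X)]$, $S\subseteq D$. Then, for every $S\subseteq D$, $$m^{(\mathrm{sens})}(S)=\mathbb{V}[f^{(c)}_S(X)]+\sum_{\substack{L\cup L'=S\\ L\neq L'}}\mathrm{cov}\big(f^{(c)}_L(X),f^{(c)}_{L'}(X)\big),$$ where the sum runs over ordered pairs $(L,L')$ of distinct subsets of $D$ with $L\cup L'=S$. If the features $X_1,\dots,X_d$ are independent, then $$m^{(\mathrm{sens})}(S)=\mathbb{V}[f^{(c)}_S(X)]\qquad\text{for every }S\subseteq D.$$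
   Context: Conditional fANOVA: for $S\subseteq D$ the value function is $F^{(c)}_S(x):=\mathbb{E}[F(X)\mid X_S=x_S]$, and the effects are defined recursively by $f^{(c)}_S(x):=F^{(c)}_S(x)-\sum_{T\subsetneq S}f^{(c)}_T(x)$. The Möbius transform of a set function (game) $\nu:2^D\to\mathbb{R}$ is $m(S):=\sum_{T\subseteq S}(-1)^{|S|-|T|}\nu(T)$. $\mathbb{V}$ denotes variance and $\mathrm{cov}$ covariance. *)

theory Defs
  imports "HOL-Probability.Probability"
begin

text \<open>
  \<open>\<real>\<^sup>I\<close> with its Borel sigma-algebra, for a finite index set \<open>I\<close>. Its points are the functions
  \<open>nat \<Rightarrow> real\<close> that are \<open>undefined\<close> outside \<open>I\<close>, so that \<open>restrict x S\<close> is the subvector \<open>x\<^sub>S\<close>.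
\<close>

abbreviation real_vec :: "nat set \<Rightarrow> (nat \<Rightarrow> real) measure" where
  "real_vec I \<equiv> PiM I (\<lambda>_. borel)"

text \<open>
  \<open>is_cond_exp_given M Y N Z g\<close>: the function \<open>g\<close> on the state space \<open>N\<close> of \<open>Y\<close> is a version of
  \<open>y \<mapsto> E[Z | Y = y]\<close>, i.e. \<open>g(Y) = E[Z | \<sigma>(Y)]\<close> almost surely. Such a \<open>g\<close> is unique only up to null
  sets of the law of \<open>Y\<close>.
\<close>

definition is_cond_exp_given ::
  "'a measure \<Rightarrow> ('a \<Rightarrow> 'b) \<Rightarrow> 'b measure \<Rightarrow> ('a \<Rightarrow> real) \<Rightarrow> ('b \<Rightarrow> real) \<Rightarrow> bool" where
  "is_cond_exp_given M Y N Z g \<longleftrightarrow>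
     g \<in> borel_measurable N \<and>
     (AE \<omega> in M. g (Y \<omega>) = real_cond_exp M (vimage_algebra (space M) Y N) Z \<omega>)"

definition is_cond_value_function ::
  "'a measure \<Rightarrow> nat set \<Rightarrow> ('a \<Rightarrow> nat \<Rightarrow> real) \<Rightarrow> ((nat \<Rightarrow> real) \<Rightarrow> real) \<Rightarrow>
     (nat set \<Rightarrow> (nat \<Rightarrow> real) \<Rightarrow> real) \<Rightarrow> bool" where
  "is_cond_value_function M D X F V \<longleftrightarrow>
     (\<forall>S\<subseteq>D. \<exists>g.
        is_cond_exp_given M (\<lambda>\<omega>. restrict (X \<omega>) S) (real_vec S) (\<lambda>\<omega>. F (X \<omega>)) g \<and>
        (\<forall>x\<in>space (real_vec D). V S x = g (restrict x S)))"

text \<open>The effects determined by a value function. Only finite \<open>S\<close> matter; the value \<open>0\<close> at infinite \<open>S\<close>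
  is a dummy that makes the recursion terminate.\<close>

function fanova_effect ::
  "(nat set \<Rightarrow> 'b \<Rightarrow> real) \<Rightarrow> nat set \<Rightarrow> 'b \<Rightarrow> real" where
  "fanova_effect V S x =
     (if finite S then V S x - (\<Sum>T | T \<subset> S. fanova_effect V T x) else 0)"
  by pat_completeness auto
termination
  by (relation "Wellfounded.measure (\<lambda>(V, S, x). card S)") (auto intro: psubset_card_mono)

declare fanova_effect.simps [simp del]

definition moebius_transform :: "('i set \<Rightarrow> real) \<Rightarrow> 'i set \<Rightarrow> real" where
  "moebius_transform \<nu> S = (\<Sum>T\<in>Pow S. (- 1) ^ (card S - card T) * \<nu> T)"

definition covariance :: "'a measure \<Rightarrow> ('a \<Rightarrow> real) \<Rightarrow> ('a \<Rightarrow> real) \<Rightarrow> real" where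
  "covariance M Y Z =
     prob_space.expectation M
       (\<lambda>\<omega>. (Y \<omega> - prob_space.expectation M Y) * (Z \<omega> - prob_space.expectation M Z))"

definition sensitivity_game ::
  "'a measure \<Rightarrow> ('a \<Rightarrow> 'b) \<Rightarrow> (nat set \<Rightarrow> 'b \<Rightarrow> real) \<Rightarrow> nat set \<Rightarrow> real" where
  "sensitivity_game M X V S = prob_space.variance M (\<lambda>\<omega>. V S (X \<omega>))"

text \<open>Conditional value functions exist, by the Doob--Dynkin factorization lemma.\<close>

lemma factor_through_vimage_algebra_ennreal:
  fixes h :: "'a \<Rightarrow> ennreal"
  assumes Y: "Y \<in> \<Omega> \<rightarrow> space N"
    and h: "h \<in> borel_measurable (vimage_algebra \<Omega> Y N)"
  shows "\<exists>g\<in>borel_measurable N. \<forall>\<omega>\<in>\<Omega>. h \<omega> = g (Y \<omega>)"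
  using h
proof (induction h rule: borel_measurable_induct)
  case (cong f g)
  then show ?case by simp
next
  case (set A)
  then obtain B where B: "B \<in> sets N" "A = Y -` B \<inter> \<Omega>"
    using sets_vimage_algebra2[OF Y] by auto
  then show ?case
    by (intro bexI[of _ "indicator B"]) (auto split: split_indicator)
next
  case (mult u c)
  obtain g where g: "g \<in> borel_measurable N" "\<forall>\<omega>\<in>\<Omega>. u \<omega> = g (Y \<omega>)"
    using mult.IH by blast
  have "(\<lambda>y. c * g y) \<in> borel_measurable N"
    using g(1) by measurable
  moreover have "\<forall>\<omega>\<in>\<Omega>. c * u \<omega> = c * g (Y \<omega>)"
    using g(2) by simp
  ultimately show ?case by (intro bexI[of _ "\<lambda>y. c * g y"])
next
  case (add u v)
  obtain g where g: "g \<in> borel_measurable N" "\<forall>\<omega>\<in>\<Omega>. u \<omega> = g (Y \<omega>)"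
    using add.IH(1) by blast
  obtain g' where g': "g' \<in> borel_measurable N" "\<forall>\<omega>\<in>\<Omega>. v \<omega> = g' (Y \<omega>)"
    using add.IH(2) by blast
  have "(\<lambda>y. g' y + g y) \<in> borel_measurable N"
    using g(1) g'(1) by measurable
  moreover have "\<forall>\<omega>\<in>\<Omega>. v \<omega> + u \<omega> = g' (Y \<omega>) + g (Y \<omega>)"
    using g(2) g'(2) by simp
  ultimately show ?case by (intro bexI[of _ "\<lambda>y. g' y + g y"])
next
  case (seq U)
  obtain g where g: "\<And>i. g i \<in> borel_measurable N" "\<And>i. \<forall>\<omega>\<in>\<Omega>. U i \<omega> = g i (Y \<omega>)"
    using seq.IH by metis
  have "(\<lambda>y. SUP i. g i y) \<in> borel_measurable N"
    using g(1) by measurable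
  moreover have "\<forall>\<omega>\<in>\<Omega>. (SUP i. U i) \<omega> = (SUP i. g i (Y \<omega>))"
    using g(2) by (simp add: image_comp)
  ultimately show ?case by (intro bexI[of _ "\<lambda>y. SUP i. g i y"])
qed

lemma factor_through_vimage_algebra:
  fixes h :: "'a \<Rightarrow> real"
  assumes Y: "Y \<in> \<Omega> \<rightarrow> space N"
    and h: "h \<in> borel_measurable (vimage_algebra \<Omega> Y N)"
  shows "\<exists>g\<in>borel_measurable N. \<forall>\<omega>\<in>\<Omega>. h \<omega> = g (Y \<omega>)"
proof -
  have "(\<lambda>\<omega>. ennreal (h \<omega>)) \<in> borel_measurable (vimage_algebra \<Omega> Y N)"
    using h by measurable
  from factor_through_vimage_algebra_ennreal[OF Y this]
  obtain p where p: "p \<in> borel_measurable N" "\<forall>\<omega>\<in>\<Omega>. ennreal (h \<omega>) = p (Y \<omega>)"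
    by blast
  have "(\<lambda>\<omega>. ennreal (- h \<omega>)) \<in> borel_measurable (vimage_algebra \<Omega> Y N)"
    using h by measurable
  from factor_through_vimage_algebra_ennreal[OF Y this]
  obtain n where n: "n \<in> borel_measurable N" "\<forall>\<omega>\<in>\<Omega>. ennreal (- h \<omega>) = n (Y \<omega>)"
    by blast
  have "h \<omega> = enn2real (p (Y \<omega>)) - enn2real (n (Y \<omega>))" if "\<omega> \<in> \<Omega>" for \<omega>
  proof -
    have "p (Y \<omega>) = ennreal (h \<omega>)" "n (Y \<omega>) = ennreal (- h \<omega>)"
      using p(2) n(2) that by simp_all
    then show ?thesis
      by (cases "h \<omega> \<ge> 0") (simp_all add: ennreal_neg)
  qed
  moreover have "(\<lambda>y. enn2real (p y) - enn2real (n y)) \<in> borel_measurable N"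
    using p(1) n(1) by measurable
  ultimately show ?thesis
    by (intro bexI[of _ "\<lambda>y. enn2real (p y) - enn2real (n y)"] ballI)
qed

lemma ex_is_cond_exp_given:
  assumes "Y \<in> measurable M N"
  shows "\<exists>g. is_cond_exp_given M Y N Z g"
proof -
  have "Y \<in> space M \<rightarrow> space N"
    using measurable_space[OF assms] by blast
  from factor_through_vimage_algebra[OF this borel_measurable_cond_exp]
  obtain g where "g \<in> borel_measurable N"
    and eq: "\<forall>\<omega>\<in>space M. real_cond_exp M (vimage_algebra (space M) Y N) Z \<omega> = g (Y \<omega>)"
    by blast
  moreover have "AE \<omega> in M. g (Y \<omega>) = real_cond_exp M (vimage_algebra (space M) Y N) Z \<omega>"
    using eq by (intro AE_I2) simp
  ultimately show ?thesis
    unfolding is_cond_exp_given_def by blast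
qed

lemma ex_is_cond_value_function:
  assumes "X \<in> measurable M (real_vec D)"
  shows "\<exists>V. is_cond_value_function M D X F V"
proof -
  have "\<exists>g. is_cond_exp_given M (\<lambda>\<omega>. restrict (X \<omega>) S) (real_vec S) (\<lambda>\<omega>. F (X \<omega>)) g"
    if "S \<subseteq> D" for S
    by (intro ex_is_cond_exp_given measurable_compose[OF assms] measurable_restrict_subset that)
  then obtain g where "\<And>S. S \<subseteq> D \<Longrightarrow>
      is_cond_exp_given M (\<lambda>\<omega>. restrict (X \<omega>) S) (real_vec S) (\<lambda>\<omega>. F (X \<omega>)) (g S)"
    by metis
  then show ?thesis
    unfolding is_cond_value_function_def
    by (intro exI[of _ "\<lambda>S x. g S (restrict x S)"]) auto
qed

end

theory Submission
  imports Defs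
begin

text \<open>
  Moebius inversion gives \<open>F\<^sub>S = \<Sum>T\<subseteq>S. f\<^sub>T\<close>, so \<open>V[F\<^sub>S]\<close> is the sum of \<open>cov(f\<^sub>L, f\<^sub>L')\<close> over all pairs with
  \<open>L \<union> L' \<subseteq> S\<close>. Grouping the pairs by their union and inverting once more yields the general formula.
  For independent features \<open>cov(F\<^sub>A, F\<^sub>B) = V[F\<^sub>C]\<close> with \<open>C = A \<inter> B\<close>. Hence, for \<open>i \<in> L - L'\<close> and \<open>B \<subseteq> L'\<close>,
  the game \<open>A \<mapsto> cov(F\<^sub>A, F\<^sub>B)\<close> does not change when \<open>i\<close> is added to \<open>A\<close>, and its Moebius transform at \<open>L\<close>,
  which is \<open>cov(f\<^sub>L, F\<^sub>B)\<close>, vanishes; so distinct effects are uncorrelated.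
\<close>

section \<open>Moebius transforms of games on finite sets\<close>

lemma moebius_transform_cong:
  assumes "\<And>T. T \<subseteq> S \<Longrightarrow> \<nu> T = \<nu>' T"
  shows "moebius_transform \<nu> S = moebius_transform \<nu>' S"
  unfolding moebius_transform_def using assms by (intro sum.cong) auto

text \<open>Subsets of \<open>S\<close> pair off as \<open>T\<close> and \<open>insert i T\<close>
  with \<open>i\<close> not in \<open>T\<close>. The two signs are opposite and the two values
  agree, so each pair cancels.\<close>

lemma moebius_transform_eq_0:
  fixes \<nu> :: "'i set \<Rightarrow> real"
  assumes "finite S" "i \<in> S"
    and toggle: "\<And>T. T \<subseteq> S - {i} \<Longrightarrow> \<nu> (insert i T) = \<nu> T"
  shows "moebius_transform \<nu> S = 0"
proof -
  define R where "R = S - {i}"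
  have R: "finite R" "i \<notin> R" "S = insert i R"
    using assms(1,2) by (auto simp: R_def)
  define sgn where "sgn T = (- 1 :: real) ^ (card S - card T)" for T :: "'i set"
  have flip: "sgn T * \<nu> T + sgn (insert i T) * \<nu> (insert i T) = 0" if "T \<in> Pow R" for T
  proof -
    from that have T: "T \<subseteq> R" "finite T" "i \<notin> T"
      using R finite_subset by auto
    \<comment> \<open>This bound keeps the natural-number subtraction in the exponent from
      truncating: the exponent for \<open>T\<close> is then exactly one more than the one for
      \<open>insert i T\<close>.\<close>
    have "card T \<le> card R" using T(1) R(1) by (rule card_mono[rotated])
    then have "sgn T = - sgn (insert i T)"
      using R T by (simp add: sgn_def Suc_diff_le)
    moreover have "\<nu> (insert i T) = \<nu> T" using toggle T(1) by (simp add: R_def)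
    ultimately show ?thesis by simp
  qed
  have "moebius_transform \<nu> S = (\<Sum>T\<in>Pow R \<union> insert i ` Pow R. sgn T * \<nu> T)"
    unfolding moebius_transform_def sgn_def R(3) Pow_insert ..
  also have "\<dots> = (\<Sum>T\<in>Pow R. sgn T * \<nu> T) + (\<Sum>T\<in>insert i ` Pow R. sgn T * \<nu> T)"
    using R by (intro sum.union_disjoint) auto
  also have "(\<Sum>T\<in>insert i ` Pow R. sgn T * \<nu> T) = (\<Sum>T\<in>Pow R. sgn (insert i T) * \<nu> (insert i T))"
    using R(2) by (subst sum.reindex) (auto simp: inj_on_def)
  finally show ?thesis
    using flip by (simp flip: sum.distrib)
qed

text \<open>Moebius inversion. By linearity it is enough to treat the unanimity games
  \<open>e U\<close>. If \<open>U\<close> is a proper subset of \<open>S\<close>, some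
  \<open>i\<close> in \<open>S - U\<close> never affects whether \<open>U\<close> is contained in
  \<open>T\<close>, so the transform of \<open>e U\<close> vanishes at \<open>S\<close>; only
  \<open>U = S\<close> survives.\<close>

lemma moebius_transform_sum_Pow:
  fixes g :: "'i set \<Rightarrow> real"
  assumes "finite S"
  shows "moebius_transform (\<lambda>T. \<Sum>U\<in>Pow T. g U) S = g S"
proof -
  define e where "e U T = (if U \<subseteq> T then 1 else 0 :: real)" for U T :: "'i set"
  have e: "moebius_transform (e U) S = (if U = S then 1 else 0)" if "U \<subseteq> S" for U
  proof (cases "U = S")
    case True
    have "moebius_transform (e U) S = (\<Sum>T\<in>{S}. (- 1) ^ (card S - card T) * e U T)"
      unfolding moebius_transform_def using assms True
      by (intro sum.mono_neutral_right) (auto simp: e_def)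
    then show ?thesis using True by (simp add: e_def)
  next
    case False
    then obtain i where "i \<in> S" "i \<notin> U" using \<open>U \<subseteq> S\<close> by blast
    then have "moebius_transform (e U) S = 0"
      using assms by (intro moebius_transform_eq_0) (auto simp: e_def)
    then show ?thesis using False by simp
  qed
  \<comment> \<open>Moving the condition on \<open>U\<close> into the factor \<open>e U T\<close>
    frees the index set from \<open>T\<close>, so that the two sums can be swapped.\<close>
  have "moebius_transform (\<lambda>T. \<Sum>U\<in>Pow T. g U) S = moebius_transform (\<lambda>T. \<Sum>U\<in>Pow S. g U * e U T) S"
  proof (rule moebius_transform_cong)
    fix T assume "T \<subseteq> S"
    then show "(\<Sum>U\<in>Pow T. g U) = (\<Sum>U\<in>Pow S. g U * e U T)"
      using assms by (intro sum.mono_neutral_cong_left) (auto simp: e_def)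
  qed
  also have "\<dots> = (\<Sum>U\<in>Pow S. g U * moebius_transform (e U) S)"
    unfolding moebius_transform_def sum_distrib_left
    by (subst sum.swap) (simp add: mult_ac)
  also have "\<dots> = (\<Sum>U\<in>Pow S. if U = S then g U else 0)"
    using e by (intro sum.cong) auto
  also have "\<dots> = g S" using assms by simp
  finally show ?thesis .
qed

section \<open>Effects and value function\<close>

lemma sum_fanova_effect:
  assumes "finite S"
  shows "(\<Sum>T\<in>Pow S. fanova_effect V T x) = V S x"
proof -
  have "Pow S = insert S {T. T \<subset> S}" by auto
  moreover have "finite {T. T \<subset> S}"
    using assms by (rule rev_finite_subset[OF finite_Pow_iff[THEN iffD2]]) auto
  ultimately show ?thesis
    using assms by (simp add: fanova_effect.simps[of V S])
qed

text \<open>Inverting the decomposition replaces the recursion by a signed finite sum of values. In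
  this form the effects inherit integrability from the values, and covariances expand by
  linearity.\<close>

lemma fanova_effect_eq_moebius_transform:
  assumes "finite S"
  shows "fanova_effect V S x = moebius_transform (\<lambda>T. V T x) S"
proof -
  have "moebius_transform (\<lambda>T. V T x) S = moebius_transform (\<lambda>T. \<Sum>U\<in>Pow T. fanova_effect V U x) S"
    using assms by (intro moebius_transform_cong sum_fanova_effect[symmetric]) (rule finite_subset)
  then show ?thesis using moebius_transform_sum_Pow[OF assms] by simp
qed

section \<open>Square integrability and covariance\<close>

text \<open>Membership in \<open>L^2\<close> for functions rather than almost-everywhere classes.
  Measurability is demanded separately because it does not follow from that of the square.\<close>

definition square_integrable :: "'a measure \<Rightarrow> ('a \<Rightarrow> real) \<Rightarrow> bool" where
  "square_integrable M f \<longleftrightarrow> f \<in> borel_measurable M \<and> integrable M (\<lambda>x. (f x)\<^sup>2)"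

lemma square_integrable_mult:
  assumes "square_integrable M f" "square_integrable M g"
  shows "integrable M (\<lambda>x. f x * g x)"
proof (rule Bochner_Integration.integrable_bound)
  show "integrable M (\<lambda>x. (f x)\<^sup>2 + (g x)\<^sup>2)" "(\<lambda>x. f x * g x) \<in> borel_measurable M"
    using assms by (auto simp: square_integrable_def)
  have "\<bar>a * b\<bar> \<le> a\<^sup>2 + b\<^sup>2" for a b :: real
    using sum_squares_bound[of "\<bar>a\<bar>" "\<bar>b\<bar>"] mult_nonneg_nonneg[of "\<bar>a\<bar>" "\<bar>b\<bar>"]
    unfolding abs_mult power2_abs by linarith
  then show "AE x in M. norm (f x * g x) \<le> norm ((f x)\<^sup>2 + (g x)\<^sup>2)"
    by simp
qed

lemma square_integrable_cmult:
  assumes "square_integrable M f"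
  shows "square_integrable M (\<lambda>x. c * f x)"
  using assms by (auto simp: square_integrable_def power_mult_distrib)

lemma square_integrable_add:
  assumes "square_integrable M f" "square_integrable M g"
  shows "square_integrable M (\<lambda>x. f x + g x)"
  using assms square_integrable_mult[OF assms]
  by (auto simp: square_integrable_def power2_sum mult.assoc)

lemma square_integrable_sum:
  assumes "\<And>i. i \<in> I \<Longrightarrow> square_integrable M (f i)"
  shows "square_integrable M (\<lambda>x. \<Sum>i\<in>I. f i x)"
  using assms
proof (induction I rule: infinite_finite_induct)
  case (insert i I)
  then show ?case by (simp add: square_integrable_add)
qed (simp_all add: square_integrable_def)

context prob_space
begin

text \<open>The constant 1 is square integrable because the total mass is finite, so products with
  it are integrable.\<close>

lemma square_integrable_integrable:
  assumes "square_integrable M f"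
  shows "integrable M f"
  using square_integrable_mult[OF assms, of "\<lambda>_. 1"] by (simp add: square_integrable_def)

lemma covariance_commute: "covariance M Y Z = covariance M Z Y"
  by (simp add: covariance_def mult.commute)

lemma variance_eq_covariance: "variance Y = covariance M Y Y"
  by (simp add: covariance_def power2_eq_square)

lemma covariance_eq:
  assumes "square_integrable M Y" "square_integrable M Z"
  shows "covariance M Y Z = expectation (\<lambda>\<omega>. Y \<omega> * Z \<omega>) - expectation Y * expectation Z"
  using assms[THEN square_integrable_integrable] square_integrable_mult[OF assms]
  by (simp add: covariance_def algebra_simps prob_space)

text \<open>The coefficients let one statement serve both the signed sums of the Moebius transform
  and, with all of them 1, the decomposition of a value into effects.\<close>

lemma covariance_sum_left:
  assumes Y: "\<And>i. i \<in> I \<Longrightarrow> square_integrable M (Y i)" and Z: "square_integrable M Z"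
  shows "covariance M (\<lambda>\<omega>. \<Sum>i\<in>I. c i * Y i \<omega>) Z = (\<Sum>i\<in>I. c i * covariance M (Y i) Z)"
proof -
  have "square_integrable M (\<lambda>\<omega>. \<Sum>i\<in>I. c i * Y i \<omega>)"
    using Y by (intro square_integrable_sum square_integrable_cmult)
  moreover have "expectation (\<lambda>\<omega>. (\<Sum>i\<in>I. c i * Y i \<omega>) * Z \<omega>) =
      (\<Sum>i\<in>I. c i * expectation (\<lambda>\<omega>. Y i \<omega> * Z \<omega>))"
    using square_integrable_mult[OF Y Z]
    by (simp add: sum_distrib_right mult.assoc Bochner_Integration.integral_sum)
  moreover have "expectation (\<lambda>\<omega>. \<Sum>i\<in>I. c i * Y i \<omega>) = (\<Sum>i\<in>I. c i * expectation (Y i))"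
    using Y[THEN square_integrable_integrable] by (simp add: Bochner_Integration.integral_sum)
  ultimately show ?thesis
    using Y Z by (simp add: covariance_eq sum_distrib_right sum_subtractf right_diff_distrib mult.assoc)
qed

lemma covariance_sum_right:
  assumes "\<And>i. i \<in> I \<Longrightarrow> square_integrable M (Y i)" "square_integrable M Z"
  shows "covariance M Z (\<lambda>\<omega>. \<Sum>i\<in>I. c i * Y i \<omega>) = (\<Sum>i\<in>I. c i * covariance M Z (Y i))"
  using covariance_sum_left[OF assms] by (simp add: covariance_commute)

end

section \<open>Values as conditional expectations\<close>

text \<open>This is \<open>sigma(X_S)\<close>, in the form that \<open>is_cond_exp_given\<close>
  produces for the subvector.\<close>

abbreviation subvector_algebra ::
  "'a measure \<Rightarrow> ('a \<Rightarrow> nat \<Rightarrow> real) \<Rightarrow> nat set \<Rightarrow> 'a measure" where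
  "subvector_algebra M X S \<equiv> vimage_algebra (space M) (\<lambda>\<omega>. restrict (X \<omega>) S) (real_vec S)"

locale cond_value_function = prob_space M for M :: "'a measure" +
  fixes D :: "nat set" and X :: "'a \<Rightarrow> nat \<Rightarrow> real" and F :: "(nat \<Rightarrow> real) \<Rightarrow> real"
    and V :: "nat set \<Rightarrow> (nat \<Rightarrow> real) \<Rightarrow> real"
  assumes finite_D: "finite D"
    and X [measurable]: "X \<in> measurable M (real_vec D)"
    and F [measurable]: "F \<in> borel_measurable (real_vec D)"
    and F_square: "integrable M (\<lambda>\<omega>. (F (X \<omega>))\<^sup>2)"
    and V: "is_cond_value_function M D X F V"
begin

abbreviation "FX \<equiv> (\<lambda>\<omega>. F (X \<omega>))"
abbreviation "VX \<equiv> (\<lambda>S \<omega>. V S (X \<omega>))"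
abbreviation "fX \<equiv> (\<lambda>S \<omega>. fanova_effect V S (X \<omega>))"
abbreviation "G \<equiv> subvector_algebra M X"

lemma square_integrable_FX: "square_integrable M FX"
  using F_square by (simp add: square_integrable_def)

lemma integrable_FX: "integrable M FX"
  using square_integrable_FX by (rule square_integrable_integrable)

lemma measurable_subvector:
  assumes "S \<subseteq> D"
  shows "(\<lambda>\<omega>. restrict (X \<omega>) S) \<in> measurable M (real_vec S)"
  by (rule measurable_compose[OF X measurable_restrict_subset[OF assms]])

lemma measurable_subvector_algebra:
  assumes "S \<subseteq> D"
  shows "(\<lambda>\<omega>. restrict (X \<omega>) S) \<in> measurable (G S) (real_vec S)"
  using measurable_space[OF measurable_subvector[OF assms]] by (intro measurable_vimage_algebra1) auto

lemma subalgebra_subvector: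
  assumes "S \<subseteq> D"
  shows "subalgebra M (G S)"
  unfolding subalgebra_def
  using sets_image_in_sets[OF refl measurable_subvector[OF assms]] by simp

text \<open>The projection onto \<open>S\<close> factors through the projection onto
  \<open>T\<close>. This nesting is what the tower property needs.\<close>

lemma subalgebra_subvector_mono:
  assumes "S \<subseteq> T" "T \<subseteq> D"
  shows "subalgebra (G T) (G S)"
proof -
  have "(\<lambda>\<omega>. restrict (restrict (X \<omega>) T) S) \<in> measurable (G T) (real_vec S)"
    by (rule measurable_compose[OF measurable_subvector_algebra[OF assms(2)]
          measurable_restrict_subset[OF assms(1)]])
  moreover have "restrict (restrict x T) S = restrict x S" for x :: "nat \<Rightarrow> real"
    using assms(1) by (simp add: Int_absorb1)
  ultimately show ?thesis
    unfolding subalgebra_def by (intro conjI sets_image_in_sets) simp_all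
qed

lemma sigma_finite_subalgebra_subvector:
  assumes "S \<subseteq> D"
  shows "sigma_finite_subalgebra M (G S)"
  by (intro finite_measure_subalgebra.intro finite_measure_subalgebra_is_sigma_finite
      finite_measure_subalgebra_axioms.intro subalgebra_subvector assms finite_measure_axioms)

text \<open>Two different facts about the chosen version are kept: the factorization through the
  subvector holds at every point, the identity with the conditional expectation only almost
  everywhere.\<close>

lemma VX_factor:
  assumes "S \<subseteq> D"
  obtains g where "g \<in> borel_measurable (real_vec S)"
    "\<And>\<omega>. \<omega> \<in> space M \<Longrightarrow> VX S \<omega> = g (restrict (X \<omega>) S)"
    "AE \<omega> in M. VX S \<omega> = real_cond_exp M (G S) FX \<omega>"
proof -
  obtain g where g: "is_cond_exp_given M (\<lambda>\<omega>. restrict (X \<omega>) S) (real_vec S) FX g"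
    "\<forall>x\<in>space (real_vec D). V S x = g (restrict x S)"
    using V assms unfolding is_cond_value_function_def by blast
  have eq: "VX S \<omega> = g (restrict (X \<omega>) S)" if "\<omega> \<in> space M" for \<omega>
    using g(2) measurable_space[OF X that] by blast
  have "AE \<omega> in M. g (restrict (X \<omega>) S) = real_cond_exp M (G S) FX \<omega>"
    using g(1) unfolding is_cond_exp_given_def by blast
  then have "AE \<omega> in M. VX S \<omega> = real_cond_exp M (G S) FX \<omega>"
    using AE_space by eventually_elim (simp add: eq)
  with eq g(1) show ?thesis
    using that unfolding is_cond_exp_given_def by blast
qed

text \<open>It is the pointwise factorization that gives measurability in \<open>G S\<close>;
  agreement almost everywhere with a \<open>G S\<close>-measurable function would not
  suffice.\<close>

lemma borel_measurable_VX:
  assumes "S \<subseteq> D"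
  shows "VX S \<in> borel_measurable (G S)"
proof -
  obtain g where g: "g \<in> borel_measurable (real_vec S)"
    "\<And>\<omega>. \<omega> \<in> space M \<Longrightarrow> VX S \<omega> = g (restrict (X \<omega>) S)"
    using VX_factor[OF assms] by metis
  have "(\<lambda>\<omega>. g (restrict (X \<omega>) S)) \<in> borel_measurable (G S)"
    by (rule measurable_compose[OF measurable_subvector_algebra[OF assms] g(1)])
  then show ?thesis
    using g(2) by (subst measurable_cong[of _ _ "\<lambda>\<omega>. g (restrict (X \<omega>) S)"]) simp_all
qed

lemma borel_measurable_VX':
  assumes "S \<subseteq> D"
  shows "VX S \<in> borel_measurable M"
  using subalgebra_subvector[OF assms] borel_measurable_VX[OF assms] by (rule measurable_from_subalg)

lemma VX_AE_eq:
  assumes "S \<subseteq> D"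
  shows "AE \<omega> in M. VX S \<omega> = real_cond_exp M (G S) FX \<omega>"
  using VX_factor[OF assms] by metis

text \<open>Conditional Jensen inequality for the convex function \<open>x\<^sup>2\<close>, carried
  over to \<open>VX S\<close> by almost-everywhere equality.\<close>

lemma square_integrable_VX:
  assumes "S \<subseteq> D"
  shows "square_integrable M (VX S)"
proof -
  interpret sigma_finite_subalgebra M "G S"
    using assms by (rule sigma_finite_subalgebra_subvector)
  have "integrable M (\<lambda>\<omega>. (real_cond_exp M (G S) FX \<omega>)\<^sup>2)"
    using F_square by (intro integrable_convex_cond_exp[where I = UNIV and q = "\<lambda>x. x\<^sup>2"])
      (auto simp: integrable_FX convex_power2)
  then have "integrable M (\<lambda>\<omega>. (VX S \<omega>)\<^sup>2)"
  proof (rule integrable_cong_AE_imp)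
    show "AE \<omega> in M. (real_cond_exp M (G S) FX \<omega>)\<^sup>2 = (VX S \<omega>)\<^sup>2"
      using VX_AE_eq[OF assms] by eventually_elim simp
  qed (intro borel_measurable_power borel_measurable_VX' assms)
  then show ?thesis using assms by (simp add: square_integrable_def borel_measurable_VX')
qed

lemma expectation_VX:
  assumes "S \<subseteq> D"
  shows "expectation (VX S) = expectation FX"
proof -
  interpret sigma_finite_subalgebra M "G S"
    using assms by (rule sigma_finite_subalgebra_subvector)
  have "expectation (VX S) = expectation (real_cond_exp M (G S) FX)"
    using VX_AE_eq[OF assms]  by (intro integral_cong_AE borel_measurable_VX' assms) auto
  then show ?thesis using real_cond_exp_int(2)[OF integrable_FX] by simp
qed

lemma expectation_mult_VX:
  assumes ST: "S \<subseteq> T" "T \<subseteq> D"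
    and h: "h \<in> borel_measurable (G S)" and int: "integrable M (\<lambda>\<omega>. h \<omega> * VX T \<omega>)"
  shows "expectation (\<lambda>\<omega>. h \<omega> * VX T \<omega>) = expectation (\<lambda>\<omega>. h \<omega> * VX S \<omega>)"
proof -
  have SD: "S \<subseteq> D" using ST by blast
  interpret sigma_finite_subalgebra M "G S"
    using SD by (rule sigma_finite_subalgebra_subvector)
  have [measurable]: "h \<in> borel_measurable M"
    using subalgebra_subvector[OF SD] h by (rule measurable_from_subalg)
  have "AE \<omega> in M. real_cond_exp M (G S) (VX T) \<omega> =
      real_cond_exp M (G S) (real_cond_exp M (G T) FX) \<omega>"
    using VX_AE_eq[OF ST(2)] by (intro real_cond_exp_cong borel_measurable_VX' ST(2)) auto
  moreover have "AE \<omega> in M. real_cond_exp M (G S) (real_cond_exp M (G T) FX) \<omega> =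
      real_cond_exp M (G S) FX \<omega>"
    using ST by (intro real_cond_exp_nested_subalg subalgebra_subvector subalgebra_subvector_mono integrable_FX)
  ultimately have "AE \<omega> in M. h \<omega> * real_cond_exp M (G S) (VX T) \<omega> = h \<omega> * VX S \<omega>"
    using VX_AE_eq[OF SD] by eventually_elim simp
  then have "expectation (\<lambda>\<omega>. h \<omega> * real_cond_exp M (G S) (VX T) \<omega>) =
      expectation (\<lambda>\<omega>. h \<omega> * VX S \<omega>)"
    by (intro integral_cong_AE borel_measurable_times borel_measurable_VX' SD) auto
  then show ?thesis
    using real_cond_exp_intg(2)[OF int h borel_measurable_VX'[OF ST(2)]] by simp
qed

section \<open>Covariances of values for independent features\<close>

text \<open>Freezing: the function \<open>k\<close> integrates out the coordinates in \<open>B - A\<close> of \<open>g\<close>, which are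
  independent of those in \<open>A\<close>.\<close>

lemma indep_freezing:
  fixes g :: "(nat \<Rightarrow> real) \<Rightarrow> real"
  assumes indep: "indep_vars (\<lambda>_. borel) (\<lambda>i \<omega>. X \<omega> i) D"
    and A: "A \<subseteq> D" and B: "B \<subseteq> D" and g: "g \<in> borel_measurable (real_vec B)"
  shows "\<exists>k\<in>borel_measurable (real_vec (A \<inter> B)). \<forall>f\<in>borel_measurable (real_vec A).
      integrable M (\<lambda>\<omega>. f (restrict (X \<omega>) A) * g (restrict (X \<omega>) B)) \<longrightarrow>
      integrable M (\<lambda>\<omega>. f (restrict (X \<omega>) A) * k (restrict (X \<omega>) (A \<inter> B))) \<and>
      expectation (\<lambda>\<omega>. f (restrict (X \<omega>) A) * g (restrict (X \<omega>) B)) =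
      expectation (\<lambda>\<omega>. f (restrict (X \<omega>) A) * k (restrict (X \<omega>) (A \<inter> B)))"
proof -
  let ?C = "B - A"
  have C: "?C \<subseteq> D" using B by blast
  note [measurable] = measurable_subvector[OF A] measurable_subvector[OF C] g
  let ?P = "distr M (real_vec A) (\<lambda>\<omega>. restrict (X \<omega>) A)"
  let ?Q = "distr M (real_vec ?C) (\<lambda>\<omega>. restrict (X \<omega>) ?C)"
  let ?pair = "\<lambda>\<omega>. (restrict (X \<omega>) A, restrict (X \<omega>) ?C)"
  \<comment> \<open>\<open>A\<close> and \<open>B - A\<close> are disjoint blocks of independent
    coordinates. Hence the joint law of the two subvectors is a product measure and Fubini
    applies.\<close>
  have "indep_var (real_vec A) (\<lambda>\<omega>. restrict (X \<omega>) A) (real_vec ?C) (\<lambda>\<omega>. restrict (X \<omega>) ?C)"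
    using indep_var_restrict[OF indep, of A ?C] A C by auto
  then have joint: "distr M (real_vec A \<Otimes>\<^sub>M real_vec ?C) ?pair = ?P \<Otimes>\<^sub>M ?Q"
    by (simp add: indep_var_distribution_eq)
  interpret P: prob_space ?P by (rule prob_space_distr) measurable
  interpret Q: prob_space ?Q by (rule prob_space_distr) measurable
  interpret PQ: pair_prob_space ?P ?Q ..
  define k where "k u = (\<integral>z. g (merge (A \<inter> B) ?C (u, z)) \<partial>?Q)" for u
  have merge_B [measurable]:
    "merge (A \<inter> B) ?C \<in> measurable (real_vec (A \<inter> B) \<Otimes>\<^sub>M real_vec ?C) (real_vec B)"
  proof -
    have "A \<inter> B \<union> ?C = B" by blast
    then show ?thesis
      using measurable_merge[of "A \<inter> B" ?C "\<lambda>_. borel :: real measure"] by simp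
  qed
  have k [measurable]: "k \<in> borel_measurable (real_vec (A \<inter> B))"
    unfolding k_def by measurable
  have res [measurable]: "(\<lambda>y. restrict y (A \<inter> B)) \<in> measurable (real_vec A) (real_vec (A \<inter> B))"
    by (rule measurable_restrict_subset) simp
  have "integrable M (\<lambda>\<omega>. f (restrict (X \<omega>) A) * k (restrict (X \<omega>) (A \<inter> B))) \<and>
      expectation (\<lambda>\<omega>. f (restrict (X \<omega>) A) * g (restrict (X \<omega>) B)) =
      expectation (\<lambda>\<omega>. f (restrict (X \<omega>) A) * k (restrict (X \<omega>) (A \<inter> B)))"
    if f [measurable]: "f \<in> borel_measurable (real_vec A)"
      and int: "integrable M (\<lambda>\<omega>. f (restrict (X \<omega>) A) * g (restrict (X \<omega>) B))" for f
  proof -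
    \<comment> \<open>\<open>H\<close> is the integrand as a function of the two independent blocks:
      the coordinates of \<open>B\<close> are reassembled from those in \<open>A \<inter> B\<close>,
      read off \<open>y\<close>, and those in \<open>B - A\<close>, given by
      \<open>z\<close>.\<close>
    define H where "H = (\<lambda>(y, z). f y * g (merge (A \<inter> B) ?C (restrict y (A \<inter> B), z)))"
    have H [measurable]: "H \<in> borel_measurable (real_vec A \<Otimes>\<^sub>M real_vec ?C)"
      unfolding H_def by measurable
    have merge: "merge (A \<inter> B) ?C (restrict (restrict x A) (A \<inter> B), restrict x ?C) = restrict x B"
      for x :: "nat \<Rightarrow> real"
      by (auto simp: merge_def restrict_def)
    have H_pair: "H (?pair \<omega>) = f (restrict (X \<omega>) A) * g (restrict (X \<omega>) B)" for \<omega>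
      by (simp only: H_def prod.case merge)
    have "integrable (distr M (real_vec A \<Otimes>\<^sub>M real_vec ?C) ?pair) H"
      using int by (subst integrable_distr_eq) (simp_all only: H_pair, measurable)
    then have int_H: "integrable (?P \<Otimes>\<^sub>M ?Q) H"
      unfolding joint .
    \<comment> \<open>This holds for every \<open>y\<close>: where the inner integrand of
      \<open>k\<close> is not integrable, both sides are 0 by the default value of the
      integral.\<close>
    have H_int: "(\<integral>z. H (y, z) \<partial>?Q) = f y * k (restrict y (A \<inter> B))" for y
      by (simp add: H_def k_def)
    have restr: "restrict (restrict x A) (A \<inter> B) = restrict x (A \<inter> B)" for x :: "nat \<Rightarrow> real"
      by simp
    have "integrable ?P (\<lambda>y. f y * k (restrict y (A \<inter> B)))"
      using PQ.integrable_fst'[OF int_H] by (simp only: H_int)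
    then have "integrable M (\<lambda>\<omega>. f (restrict (X \<omega>) A) * k (restrict (X \<omega>) (A \<inter> B)))"
      by (subst (asm) integrable_distr_eq) (simp_all only: restr, measurable)
    moreover {
      have "expectation (\<lambda>\<omega>. f (restrict (X \<omega>) A) * g (restrict (X \<omega>) B)) =
        integral\<^sup>L (distr M (real_vec A \<Otimes>\<^sub>M real_vec ?C) ?pair) H"
        by (subst integral_distr) (simp_all only: H_pair, measurable)
      also have "\<dots> = (\<integral>y. f y * k (restrict y (A \<inter> B)) \<partial>?P)"
        unfolding joint using PQ.integral_fst'[OF int_H] by (simp only: H_int)
      also have "\<dots> = expectation (\<lambda>\<omega>. f (restrict (X \<omega>) A) * k (restrict (X \<omega>) (A \<inter> B)))"
        by (subst integral_distr) (simp_all only: restr, measurable)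
      finally have "expectation (\<lambda>\<omega>. f (restrict (X \<omega>) A) * g (restrict (X \<omega>) B)) =
        expectation (\<lambda>\<omega>. f (restrict (X \<omega>) A) * k (restrict (X \<omega>) (A \<inter> B)))" .
    }
    ultimately show ?thesis by (rule conjI)
  qed
  with k show ?thesis by (intro bexI[of _ k] ballI impI)
qed

text \<open>Write \<open>I\<close> for \<open>A \<inter> B\<close>. Freezing replaces
  \<open>VX B\<close> by a function \<open>k\<close> of \<open>X_I\<close>; the tower property then
  replaces \<open>VX A\<close> by \<open>VX I\<close>; freezing read backwards restores
  \<open>VX B\<close>; the tower property finally turns it into \<open>VX I\<close>. The same
  \<open>k\<close> serves both times, so it never has to be identified with
  \<open>VX I\<close>.\<close>

lemma expectation_mult_VX_indep:
  assumes indep: "indep_vars (\<lambda>_. borel) (\<lambda>i \<omega>. X \<omega> i) D"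
    and A: "A \<subseteq> D" and B: "B \<subseteq> D"
  shows "expectation (\<lambda>\<omega>. VX A \<omega> * VX B \<omega>) = expectation (\<lambda>\<omega>. VX (A \<inter> B) \<omega> * VX (A \<inter> B) \<omega>)"
proof -
  let ?I = "A \<inter> B"
  have I: "?I \<subseteq> D" using A by blast
  obtain a where a: "a \<in> borel_measurable (real_vec A)"
    "\<And>\<omega>. \<omega> \<in> space M \<Longrightarrow> VX A \<omega> = a (restrict (X \<omega>) A)"
    using VX_factor[OF A] by metis
  obtain b where b: "b \<in> borel_measurable (real_vec B)"
    "\<And>\<omega>. \<omega> \<in> space M \<Longrightarrow> VX B \<omega> = b (restrict (X \<omega>) B)"
    using VX_factor[OF B] by metis
  obtain c where c: "c \<in> borel_measurable (real_vec ?I)"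
    "\<And>\<omega>. \<omega> \<in> space M \<Longrightarrow> VX ?I \<omega> = c (restrict (X \<omega>) ?I)"
    using VX_factor[OF I] by metis
  \<comment> \<open>\<open>VX ?I\<close> is regarded as a function of the larger subvector
    \<open>X_A\<close>, so that freezing applies to it as well as to \<open>VX A\<close>.\<close>
  define c' where "c' y = c (restrict y ?I)" for y
  have c': "c' \<in> borel_measurable (real_vec A)"
    unfolding c'_def by (rule measurable_compose[OF measurable_restrict_subset c(1)]) simp
  have "restrict (restrict x A) ?I = restrict x ?I" for x :: "nat \<Rightarrow> real"
    by simp
  then have c'_eq: "VX ?I \<omega> = c' (restrict (X \<omega>) A)" if "\<omega> \<in> space M" for \<omega>
    using c(2)[OF that] by (simp add: c'_def)
  obtain k where k: "k \<in> borel_measurable (real_vec ?I)"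
    and freeze: "\<forall>f\<in>borel_measurable (real_vec A).
      integrable M (\<lambda>\<omega>. f (restrict (X \<omega>) A) * b (restrict (X \<omega>) B)) \<longrightarrow>
      integrable M (\<lambda>\<omega>. f (restrict (X \<omega>) A) * k (restrict (X \<omega>) ?I)) \<and>
      expectation (\<lambda>\<omega>. f (restrict (X \<omega>) A) * b (restrict (X \<omega>) B)) =
      expectation (\<lambda>\<omega>. f (restrict (X \<omega>) A) * k (restrict (X \<omega>) ?I))"
    using indep_freezing[OF indep A B b(1)] by (elim bexE)
  let ?k = "\<lambda>\<omega>. k (restrict (X \<omega>) ?I)"
  have k': "?k \<in> borel_measurable (G ?I)"
    by (rule measurable_compose[OF measurable_subvector_algebra[OF I] k])
  have frozen: "integrable M (\<lambda>\<omega>. ?k \<omega> * VX S \<omega>) \<and>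
      expectation (\<lambda>\<omega>. VX S \<omega> * VX B \<omega>) = expectation (\<lambda>\<omega>. ?k \<omega> * VX S \<omega>)"
    if S: "S \<subseteq> D" and f: "f \<in> borel_measurable (real_vec A)"
      and eq: "\<And>\<omega>. \<omega> \<in> space M \<Longrightarrow> VX S \<omega> = f (restrict (X \<omega>) A)" for S f
  proof -
    have "integrable M (\<lambda>\<omega>. VX S \<omega> * VX B \<omega>)"
      using S B by (intro square_integrable_mult square_integrable_VX)
    also have "?this \<longleftrightarrow> integrable M (\<lambda>\<omega>. f (restrict (X \<omega>) A) * b (restrict (X \<omega>) B))"
      by (rule Bochner_Integration.integrable_cong) (simp_all only: eq b(2))
    finally have frozen: "integrable M (\<lambda>\<omega>. f (restrict (X \<omega>) A) * ?k \<omega>) \<and>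
        expectation (\<lambda>\<omega>. f (restrict (X \<omega>) A) * b (restrict (X \<omega>) B)) =
        expectation (\<lambda>\<omega>. f (restrict (X \<omega>) A) * ?k \<omega>)"
      by (rule freeze[rule_format, OF f])
    have "integrable M (\<lambda>\<omega>. f (restrict (X \<omega>) A) * ?k \<omega>) \<longleftrightarrow> integrable M (\<lambda>\<omega>. ?k \<omega> * VX S \<omega>)"
      by (rule Bochner_Integration.integrable_cong) (simp_all only: eq mult.commute)
    moreover have "expectation (\<lambda>\<omega>. f (restrict (X \<omega>) A) * ?k \<omega>) = expectation (\<lambda>\<omega>. ?k \<omega> * VX S \<omega>)"
      by (rule Bochner_Integration.integral_cong) (simp_all only: eq mult.commute)
    moreover have "expectation (\<lambda>\<omega>. VX S \<omega> * VX B \<omega>) =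
        expectation (\<lambda>\<omega>. f (restrict (X \<omega>) A) * b (restrict (X \<omega>) B))"
      by (rule Bochner_Integration.integral_cong) (simp_all only: eq b(2))
    ultimately show ?thesis
      using frozen by argo
  qed
  have "expectation (\<lambda>\<omega>. VX A \<omega> * VX B \<omega>) = expectation (\<lambda>\<omega>. ?k \<omega> * VX A \<omega>)"
    using frozen[OF A a] by blast
  also have "\<dots> = expectation (\<lambda>\<omega>. ?k \<omega> * VX ?I \<omega>)"
    using frozen[OF A a] A k' by (intro expectation_mult_VX) auto
  also have "\<dots> = expectation (\<lambda>\<omega>. VX ?I \<omega> * VX B \<omega>)"
    using frozen[OF I c' c'_eq] by simp
  also have "\<dots> = expectation (\<lambda>\<omega>. VX ?I \<omega> * VX ?I \<omega>)"
    using B I by (intro expectation_mult_VX borel_measurable_VX square_integrable_mult square_integrable_VX) auto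
  finally show ?thesis .
qed

text \<open>All values have the mean of \<open>FX\<close>, so the same product of means is
  subtracted on both sides and the identity for products carries over.\<close>

lemma covariance_VX_indep:
  assumes "indep_vars (\<lambda>_. borel) (\<lambda>i \<omega>. X \<omega> i) D" "A \<subseteq> D" "B \<subseteq> D"
  shows "covariance M (VX A) (VX B) = variance (VX (A \<inter> B))"
proof -
  have "A \<inter> B \<subseteq> D" using assms by blast
  then show ?thesis
    unfolding variance_eq_covariance
    using assms expectation_mult_VX_indep[OF assms]
    by (simp add: covariance_eq square_integrable_VX expectation_VX)
qed

section \<open>Covariances of effects\<close>

lemma finite_subset_D: "S \<subseteq> D \<Longrightarrow> finite S"
  using finite_D by (rule rev_finite_subset)

lemma fX_eq:
  assumes "S \<subseteq> D"
  shows "fX S = (\<lambda>\<omega>. \<Sum>T\<in>Pow S. (- 1) ^ (card S - card T) * VX T \<omega>)"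
  by (simp add: fanova_effect_eq_moebius_transform[OF finite_subset_D[OF assms]] moebius_transform_def)

lemma square_integrable_fX:
  assumes "S \<subseteq> D"
  shows "square_integrable M (fX S)"
  unfolding fX_eq[OF assms] using assms
  by (intro square_integrable_sum square_integrable_cmult square_integrable_VX) auto

lemma covariance_fX_indep:
  assumes indep: "indep_vars (\<lambda>_. borel) (\<lambda>i \<omega>. X \<omega> i) D"
    and L: "L \<subseteq> D" "i \<in> L" and L': "L' \<subseteq> D" "i \<notin> L'"
  shows "covariance M (fX L) (fX L') = 0"
proof -
  have "covariance M (fX L) (VX B) = 0" if B: "B \<subseteq> L'" for B
  proof -
    have BD: "B \<subseteq> D" using B L' by blast
    have "covariance M (fX L) (VX B) =
        (\<Sum>A\<in>Pow L. (- 1) ^ (card L - card A) * covariance M (VX A) (VX B))"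
      unfolding fX_eq[OF L(1)] using L BD
      by (intro covariance_sum_left square_integrable_VX) auto
    also have "\<dots> = moebius_transform (\<lambda>A. variance (VX (A \<inter> B))) L"
      unfolding moebius_transform_def using L BD
      by (intro sum.cong refl) (simp add: covariance_VX_indep[OF indep])
    \<comment> \<open>Since \<open>i\<close> is not in \<open>B\<close>, adding \<open>i\<close> to
      \<open>A\<close> leaves \<open>A \<inter> B\<close> unchanged.\<close>
    also have "\<dots> = 0"
      using L L' B finite_subset_D[OF L(1)]
      by (intro moebius_transform_eq_0[where i = i]) (auto simp: Int_insert_left)
    finally show ?thesis .
  qed
  moreover have "covariance M (fX L) (fX L') =
      (\<Sum>B\<in>Pow L'. (- 1) ^ (card L' - card B) * covariance M (fX L) (VX B))"
    unfolding fX_eq[OF L'(1)] using L L'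
    by (intro covariance_sum_right square_integrable_VX square_integrable_fX) auto
  ultimately show ?thesis by simp
qed

section \<open>Moebius transform of the sensitivity game\<close>

lemma variance_VX:
  assumes "S \<subseteq> D"
  shows "variance (VX S) = (\<Sum>L\<in>Pow S. \<Sum>L'\<in>Pow S. covariance M (fX L) (fX L'))"
proof -
  \<comment> \<open>The factor 1 brings the decomposition into the shape expected by the bilinearity
    lemmas, which are applied to one argument at a time.\<close>
  have VX: "VX S = (\<lambda>\<omega>. \<Sum>L\<in>Pow S. 1 * fX L \<omega>)"
    by (simp add: sum_fanova_effect[OF finite_subset_D[OF assms]])
  have sq: "square_integrable M (fX L)" if "L \<in> Pow S" for L
    using that assms by (intro square_integrable_fX) auto
  have "variance (VX S) = covariance M (\<lambda>\<omega>. \<Sum>L\<in>Pow S. 1 * fX L \<omega>) (VX S)"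
    unfolding variance_eq_covariance by (subst (1) VX) (rule refl)
  also have "\<dots> = (\<Sum>L\<in>Pow S. 1 * covariance M (fX L) (VX S))"
    using assms sq by (intro covariance_sum_left square_integrable_VX)
  also have "\<dots> = (\<Sum>L\<in>Pow S. 1 * (\<Sum>L'\<in>Pow S. 1 * covariance M (fX L) (fX L')))"
    unfolding VX using sq by (intro sum.cong arg_cong2[where f = "(*)"] refl covariance_sum_right)
  finally show ?thesis by simp
qed

lemma moebius_transform_sensitivity_game:
  assumes S: "S \<subseteq> D"
  shows "moebius_transform (sensitivity_game M X V) S = variance (fX S) +
    (\<Sum>(L, L') \<in> {(L, L'). L \<subseteq> D \<and> L' \<subseteq> D \<and> L \<union> L' = S \<and> L \<noteq> L'}.
      covariance M (fX L) (fX L'))"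
proof -
  let ?cov = "\<lambda>(L, L'). covariance M (fX L) (fX L')"
  \<comment> \<open>Pairs with union \<open>U\<close> consist of subsets of \<open>U\<close>
    automatically. The inner sum thus depends on \<open>U\<close> alone and not on \<open>T\<close>,
    as inversion requires.\<close>
  let ?pairs = "\<lambda>U. {(L, L'). L \<union> L' = U}"
  let ?rest = "{(L, L'). L \<subseteq> D \<and> L' \<subseteq> D \<and> L \<union> L' = S \<and> L \<noteq> L'}"
  have "sensitivity_game M X V T = (\<Sum>U\<in>Pow T. \<Sum>p\<in>?pairs U. ?cov p)" if "T \<subseteq> S" for T
  proof -
    have T: "T \<subseteq> D" "finite T" using that S finite_subset_D by auto
    have "sensitivity_game M X V T = (\<Sum>p\<in>Pow T \<times> Pow T. ?cov p)"
      unfolding sensitivity_game_def variance_VX[OF T(1)] by (rule sum.cartesian_product)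
    also have "\<dots> = (\<Sum>U\<in>Pow T. \<Sum>p\<in>{p \<in> Pow T \<times> Pow T. fst p \<union> snd p = U}. ?cov p)"
      using T(2) by (intro sum.group[symmetric]) auto
    also have "\<dots> = (\<Sum>U\<in>Pow T. \<Sum>p\<in>?pairs U. ?cov p)"
      by (intro sum.cong refl) auto
    finally show ?thesis .
  qed
  then have "moebius_transform (sensitivity_game M X V) S =
      moebius_transform (\<lambda>T. \<Sum>U\<in>Pow T. \<Sum>p\<in>?pairs U. ?cov p) S"
    by (rule moebius_transform_cong)
  also have "\<dots> = (\<Sum>p\<in>?pairs S. ?cov p)"
    using finite_subset_D[OF S] by (rule moebius_transform_sum_Pow)
  \<comment> \<open>The only pair of equal sets with union \<open>S\<close> is
    \<open>(S, S)\<close>; it contributes the variance term.\<close>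
  also have "?pairs S = insert (S, S) ?rest"
    using S by auto
  also have "sum ?cov \<dots> = ?cov (S, S) + sum ?cov ?rest"
  proof (rule sum.insert)
    show "finite ?rest"
      by (rule finite_subset[of _ "Pow D \<times> Pow D"]) (auto simp: finite_D)
  qed simp
  finally show ?thesis by (simp add: variance_eq_covariance)
qed

lemma moebius_transform_sensitivity_game_indep:
  assumes "indep_vars (\<lambda>_. borel) (\<lambda>i \<omega>. X \<omega> i) D" "S \<subseteq> D"
  shows "moebius_transform (sensitivity_game M X V) S = variance (fX S)"
proof -
  have "covariance M (fX L) (fX L') = 0" if LL': "L \<subseteq> D" "L' \<subseteq> D" "L \<noteq> L'" for L L'
  proof -
    \<comment> \<open>The vanishing lemma needs an element of the first set missing from the second.
      If the distinguishing element lies on the other side, symmetry of the covariance exchanges the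
      roles.\<close>
    obtain i where "i \<in> L \<and> i \<notin> L' \<or> i \<in> L' \<and> i \<notin> L"
      using LL'(3) by blast
    then show ?thesis
      using covariance_fX_indep[OF assms(1)] LL' covariance_commute by metis
  qed
  then have "(\<Sum>(L, L') \<in> {(L, L'). L \<subseteq> D \<and> L' \<subseteq> D \<and> L \<union> L' = S \<and> L \<noteq> L'}.
      covariance M (fX L) (fX L')) = 0"
    by (intro sum.neutral) auto
  then show ?thesis
    using moebius_transform_sensitivity_game[OF assms(2)] by simp
qed

end

theorem theorem3:
  fixes M :: "'a measure" and d :: nat and D :: "nat set"
    and X :: "'a \<Rightarrow> nat \<Rightarrow> real" and F :: "(nat \<Rightarrow> real) \<Rightarrow> real"
    and V :: "nat set \<Rightarrow> (nat \<Rightarrow> real) \<Rightarrow> real"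
  assumes "prob_space M"
    and "D = {1..d}"
    and "X \<in> measurable M (real_vec D)"
    and "F \<in> borel_measurable (real_vec D)"
    and "integrable M (\<lambda>\<omega>. (F (X \<omega>))\<^sup>2)"
    and "is_cond_value_function M D X F V"
  shows "(\<forall>S\<subseteq>D. moebius_transform (sensitivity_game M X V) S =
           prob_space.variance M (\<lambda>\<omega>. fanova_effect V S (X \<omega>)) +
           (\<Sum>(L, L') \<in> {(L, L'). L \<subseteq> D \<and> L' \<subseteq> D \<and> L \<union> L' = S \<and> L \<noteq> L'}.
              covariance M (\<lambda>\<omega>. fanova_effect V L (X \<omega>)) (\<lambda>\<omega>. fanova_effect V L' (X \<omega>)))) \<and>
         (prob_space.indep_vars M (\<lambda>_. borel) (\<lambda>i \<omega>. X \<omega> i) D \<longrightarrow>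
           (\<forall>S\<subseteq>D. moebius_transform (sensitivity_game M X V) S =
              prob_space.variance M (\<lambda>\<omega>. fanova_effect V S (X \<omega>))))"
proof -
  have "finite D" using assms(2) by simp
  then interpret cond_value_function M D X F V
    using assms by (intro cond_value_function.intro cond_value_function_axioms.intro)
  show ?thesis
    by (intro conjI allI impI moebius_transform_sensitivity_game
        moebius_transform_sensitivity_game_indep)
qed

end
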